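(* For $m,k\in\mathbb{N}_0$ and $a>0$, \[ \int_0^\infty \frac{x^m\ln x\,dx}{(x-1)(x+a)^{k+m+1}} = \frac{\pi^2}{2(a+1)^{k+m+1}} + \frac{(-1)^k}{2\,k!\binom{k+m}{m}}\frac{d^k}{da^k}\left(\frac{\ln^2 a}{(a+1)^{m+1}}\right) + \sum_{j=0}^{m-1}\frac{\binom{k+j}{j}}{\binom{k+m}{m}}\,\frac{H_{m-j-1}}{m-j}\,\frac{1}{(a+1)^{j+k+1}} + \frac{(-1)^k}{k!\binom{k+m}{m}}\sum_{j=0}^{m-1}\frac{1}{m-j}\frac{d^k}{da^k}\left(\frac{\ln a}{(a+1)^{j+1}}\right). \]
   Context: $H_n=\sum_{i=1}^n \frac1i$ denotes the $n$-th harmonic number, with $H_0=0$. $\frac{d^k}{da^k}$ denotes the $k$-th derivative with respect to $a$ (the identity when $k=0$). Empty sums are zero. *)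

theory Defs
  imports "HOL-Analysis.Analysis"
begin

end

theory Submission
  imports Defs "HOL-Real_Asymp.Real_Asymp"
begin

text \<open>
  Let \<open>I m n a\<close> be the integral of \<open>x ^ m * ln x / ((x - 1) * (x + a) ^ n)\<close> over the positive
  half-line, \<open>m < n\<close>. Differentiating under the integral gives \<open>d/da I m n = - n * I m (n + 1)\<close>, and
  writing \<open>x = (x + a) - a\<close> gives \<open>I (m + 1) (n + 1) = I m n - a * I m (n + 1)\<close>. These two relations
  reduce everything to \<open>I 0 1\<close>. There, \<open>(a + 1) * I 0 1 a\<close> has derivative
  \<open>\<integral> ln x / (x + a)\<^sup>2 = ln a / a\<close>, so it equals \<open>(ln a)\<^sup>2 / 2\<close> up to a constant, and the constant is
  found at \<open>a = 1\<close> by expanding \<open>ln x / (x\<^sup>2 - 1)\<close> into a geometric series on both sides of \<open>1\<close>.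
  Induction on \<open>m\<close> yields a closed form for \<open>I m (m + 1)\<close>, and differentiating it \<open>k\<close> times gives
  the theorem.
\<close>

section \<open>Integrability of the kernel on the positive half-line\<close>

text \<open>Carries the fundamental theorem over from the Lebesgue interval integral to
  \<open>has_integral\<close>. For a nonnegative integrand, finite limits of the antiderivative at
  the two ends already force absolute integrability, so endpoints such as 0 and infinity are treated
  alike.\<close>

lemma has_integral_FTC_nonneg:
  fixes f F :: "real \<Rightarrow> real" and a b :: ereal
  assumes "a < b"
    and "\<And>x. a < ereal x \<Longrightarrow> ereal x < b \<Longrightarrow> (F has_field_derivative f x) (at x)"
    and "\<And>x. a < ereal x \<Longrightarrow> ereal x < b \<Longrightarrow> isCont f x"
    and "\<And>x. a < ereal x \<Longrightarrow> ereal x < b \<Longrightarrow> 0 \<le> f x"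
    and "((F \<circ> real_of_ereal) \<longlongrightarrow> A) (at_right a)"
    and "((F \<circ> real_of_ereal) \<longlongrightarrow> B) (at_left b)"
  shows "(f has_integral (B - A)) (einterval a b)"
    and "set_integrable lborel (einterval a b) f"
proof -
  note FTC = interval_integral_FTC_nonneg[OF assms(1-3) _ assms(5,6)]
  show int: "set_integrable lborel (einterval a b) f"
    using assms(4) by (intro FTC(1)) auto
  have "(LBINT x=a..b. f x) = B - A"
    using assms(4) by (intro FTC(2)) auto
  hence "integral (einterval a b) f = B - A"
    using \<open>a < b\<close> set_borel_integral_eq_integral(2)[OF int]
    by (simp add: interval_lebesgue_integral_le_eq)
  with set_borel_integral_eq_integral(1)[OF int]
  show "(f has_integral (B - A)) (einterval a b)"
    by (metis integrable_integral)
qed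

text \<open>With \<open>s = sqrt x\<close>, the upper bound is
  \<open>2 * ln y \<le> y - 1 / y\<close> taken at \<open>y = s\<close> when
  \<open>x \<ge> 1\<close> and at \<open>y = 1 / s\<close> when \<open>x < 1\<close>. It controls
  the kernel near 0, 1 and infinity at once.\<close>

lemma ln_over_diff_bounds:
  fixes x :: real
  assumes "x > 0"
  shows "0 \<le> ln x / (x - 1)" "ln x / (x - 1) \<le> 1 / sqrt x"
proof -
  show "0 \<le> ln x / (x - 1)"
    using assms by (cases "x \<ge> 1") (auto simp: divide_nonpos_neg)
  have lnle: "2 * ln y \<le> y - 1 / y" if "y \<ge> 1" for y :: real
  proof -
    \<comment> \<open>The difference of the two sides vanishes at 1, and its derivative is a perfect
      square.\<close>
    have "(\<lambda>y. y - 1 / y - 2 * ln y) 1 \<le> (\<lambda>y. y - 1 / y - 2 * ln y) y"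
    proof (rule DERIV_nonneg_imp_nondecreasing[OF that])
      fix t :: real assume t: "1 \<le> t" "t \<le> y"
      have "((\<lambda>y. y - 1 / y - 2 * ln y) has_real_derivative (1 - 1 / t)\<^sup>2) (at t)"
        using t by (auto intro!: derivative_eq_intros simp: power2_eq_square field_simps)
      thus "\<exists>d. ((\<lambda>y. y - 1 / y - 2 * ln y) has_real_derivative d) (at t) \<and> 0 \<le> d"
        using zero_le_power2 by blast
    qed
    thus ?thesis by simp
  qed
  define s where "s = sqrt x"
  have s: "s > 0" "x = s\<^sup>2" using assms by (auto simp: s_def)
  have lx: "ln x = 2 * ln s" using s by (simp add: ln_realpow)
  show "ln x / (x - 1) \<le> 1 / sqrt x"
  proof (cases "x \<ge> 1")
    case True
    hence "s \<ge> 1" by (simp add: s_def)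
    from lnle[OF this] have "ln x \<le> (x - 1) / s"
      using s lx by (simp add: field_simps power2_eq_square)
    \<comment> \<open>At \<open>x = 1\<close> the quotient is \<open>0 / 0\<close>, which is 0 by
      convention, so the bound still holds there.\<close>
    thus ?thesis using True s by (cases "x = 1") (auto simp: s_def[symmetric] field_simps)
  next
    case False
    hence "s \<le> 1" by (simp add: s_def)
    hence "1 / s \<ge> 1" using s by simp
    from lnle[OF this] have "- ln x \<le> 1 / s - s"
      using s lx by (simp add: ln_div)
    also have "\<dots> = (1 - x) / s"
      using s by (simp add: diff_divide_distrib power2_eq_square)
    finally have "- ln x / (1 - x) \<le> 1 / s"
      using False divide_right_mono[of "- ln x" "(1 - x) / s" "1 - x"] by simp
    moreover have "- ln x / (1 - x) = ln x / (x - 1)"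
      using minus_divide_divide[of "ln x" "x - 1"] by (simp del: minus_divide_divide)
    ultimately show ?thesis by (simp add: s_def)
  qed
qed

text \<open>The common dominating function of all kernels: \<open>1 / sqrt x\<close> comes from
  \<open>ln_over_diff_bounds\<close>, and a single factor \<open>x + a\<close> gives enough decay at
  infinity.\<close>

lemma integrable_inverse_sqrt_kernel:
  fixes a :: real
  assumes "a > 0"
  shows "set_integrable lborel {0<..} (\<lambda>x. 1 / (sqrt x * (x + a)))"
proof -
  have "set_integrable lborel (einterval (ereal 0) \<infinity>) (\<lambda>x. 1 / (sqrt x * (x + a)))"
  \<comment> \<open>Substituting \<open>s = sqrt x\<close> turns the integrand into
    \<open>2 / (s ^ 2 + a)\<close>, whence the arctangent.\<close>
  proof (rule has_integral_FTC_nonneg(2)[where F = "\<lambda>x. 2 / sqrt a * arctan (sqrt x / sqrt a)"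
        and A = 0 and B = "2 / sqrt a * (pi / 2)"])
    fix x assume "ereal 0 < ereal x"
    hence x: "x > 0" by simp
    show "((\<lambda>x. 2 / sqrt a * arctan (sqrt x / sqrt a)) has_real_derivative 1 / (sqrt x * (x + a))) (at x)"
    proof (rule DERIV_cong)
      show "((\<lambda>x. 2 / sqrt a * arctan (sqrt x / sqrt a)) has_real_derivative
              2 / sqrt a * (inverse (1 + (sqrt x / sqrt a)\<^sup>2) * (inverse (sqrt x) / 2 / sqrt a))) (at x)"
        using x by (intro DERIV_cmult DERIV_chain2[OF DERIV_arctan] DERIV_cdivide DERIV_real_sqrt)
      have "1 + (sqrt x / sqrt a)\<^sup>2 = (x + a) / a"
        using x assms by (simp add: power_divide field_simps)
      moreover have "sqrt a * sqrt a = a" using assms by simp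
      ultimately show "2 / sqrt a * (inverse (1 + (sqrt x / sqrt a)\<^sup>2) * (inverse (sqrt x) / 2 / sqrt a))
              = 1 / (sqrt x * (x + a))"
        using x assms by (simp add: divide_simps) (simp add: algebra_simps)
    qed
    show "isCont (\<lambda>x. 1 / (sqrt x * (x + a))) x"
      using x assms by (intro continuous_intros) auto
    show "0 \<le> 1 / (sqrt x * (x + a))" using x assms by auto
  next
    have "((\<lambda>x. 2 / sqrt a * arctan (sqrt x / sqrt a)) \<longlongrightarrow> 2 / sqrt a * arctan (sqrt 0 / sqrt a)) (at_right 0)"
      by (intro tendsto_intros) (use assms in auto)
    thus "(((\<lambda>x. 2 / sqrt a * arctan (sqrt x / sqrt a)) \<circ> real_of_ereal) \<longlongrightarrow> 0) (at_right (ereal 0))"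
      unfolding ereal_tendsto_simps by simp
  next
    have "filterlim (\<lambda>x. sqrt x / sqrt a) at_top at_top"
      using assms by real_asymp
    hence "((\<lambda>x. arctan (sqrt x / sqrt a)) \<longlongrightarrow> pi / 2) at_top"
      by (rule filterlim_compose[OF tendsto_arctan_at_top])
    thus "(((\<lambda>x. 2 / sqrt a * arctan (sqrt x / sqrt a)) \<circ> real_of_ereal) \<longlongrightarrow> 2 / sqrt a * (pi / 2)) (at_left \<infinity>)"
      unfolding ereal_tendsto_simps by (intro tendsto_intros)
  qed simp
  moreover have "einterval (ereal 0) \<infinity> = {0::real<..}"
    by (auto simp: einterval_def)
  ultimately show ?thesis by simp
qed

lemma kernel_integrable_lborel:
  fixes a :: real
  assumes "a > 0" "m < n"
  shows "set_integrable lborel {0<..} (\<lambda>x. x ^ m * ln x / ((x - 1) * (x + a) ^ n))"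
proof -
  have "set_integrable lborel {0<..} (\<lambda>x. 1 / a ^ (n - m - 1) * (1 / (sqrt x * (x + a))))"
    using integrable_inverse_sqrt_kernel[OF assms(1)] by (intro set_integrable_mult_right) auto
  thus ?thesis
  proof (rule set_integrable_bound)
    show "set_borel_measurable lborel {0<..} (\<lambda>x. x ^ m * ln x / ((x - 1) * (x + a) ^ n))"
      unfolding set_borel_measurable_def by measurable
    show "AE x in lborel. x \<in> {0<..} \<longrightarrow> norm (x ^ m * ln x / ((x - 1) * (x + a) ^ n))
            \<le> norm (1 / a ^ (n - m - 1) * (1 / (sqrt x * (x + a))))"
    proof (intro AE_I2 impI)
      fix x :: real assume "x \<in> {0<..}"
      hence x: "x > 0" by simp
      \<comment> \<open>Of the \<open>n\<close> factors \<open>x + a\<close>, \<open>m\<close> are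
        paired with the factors \<open>x\<close> (each ratio at most 1), \<open>n - m - 1\<close>
        are bounded below by \<open>a\<close>, and one is kept for decay.\<close>
      have n: "n = m + (n - m - 1) + 1" using assms by simp
      have "x ^ m / (x + a) ^ n = (x / (x + a)) ^ m * (1 / (x + a)) ^ (n - m - 1) * (1 / (x + a))"
        by (subst n) (simp add: power_add field_simps power_divide)
      also have "\<dots> \<le> 1 * (1 / a) ^ (n - m - 1) * (1 / (x + a))"
        using x assms by (intro mult_mono power_mono power_le_one) (auto simp: field_simps)
      finally have le: "x ^ m / (x + a) ^ n \<le> 1 / a ^ (n - m - 1) * (1 / (x + a))"
        by (simp add: power_divide)
      have "x ^ m * ln x / ((x - 1) * (x + a) ^ n) = x ^ m / (x + a) ^ n * (ln x / (x - 1))"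
        by simp
      also have "\<dots> \<le> 1 / a ^ (n - m - 1) * (1 / (x + a)) * (1 / sqrt x)"
        using x assms ln_over_diff_bounds[OF x] by (intro mult_mono le) auto
      finally have "x ^ m * ln x / ((x - 1) * (x + a) ^ n) \<le> 1 / a ^ (n - m - 1) * (1 / (sqrt x * (x + a)))"
        by (simp add: mult_ac)
      moreover have "0 \<le> x ^ m / (x + a) ^ n * (ln x / (x - 1))"
        using x assms ln_over_diff_bounds[OF x] by (intro mult_nonneg_nonneg) auto
      ultimately show "norm (x ^ m * ln x / ((x - 1) * (x + a) ^ n))
            \<le> norm (1 / a ^ (n - m - 1) * (1 / (sqrt x * (x + a))))"
        unfolding times_divide_times_eq mult.commute[of "(x + a) ^ n"] real_norm_def
        by (metis abs_ge_self abs_of_nonneg order_trans times_divide_times_eq mult.commute)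
    qed
  qed
qed

text \<open>The \<open>I m n a\<close> of the overview. The two exponents are independent because
  differentiation in \<open>a\<close> raises only \<open>n\<close>, while the algebraic recurrence
  raises both.\<close>

definition log_kernel_integral :: "nat \<Rightarrow> nat \<Rightarrow> real \<Rightarrow> real" where
  "log_kernel_integral m n a = integral {0<..} (\<lambda>x. x ^ m * ln x / ((x - 1) * (x + a) ^ n))"

lemma kernel_integrable:
  fixes a :: real
  assumes "a > 0" "m < n"
  shows "(\<lambda>x. x ^ m * ln x / ((x - 1) * (x + a) ^ n)) integrable_on {0<..}"
  using kernel_integrable_lborel[OF assms] by (rule set_borel_integral_eq_integral(1))

section \<open>Differentiation under the integral sign and the algebraic recurrence\<close>

lemma DERIV_inverse_power:
  fixes y :: real
  assumes "y \<noteq> 0"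
  shows "((\<lambda>y. 1 / y ^ p) has_real_derivative - real p / y ^ Suc p) (at y within S)"
proof (rule DERIV_cong[OF DERIV_divide[OF DERIV_const DERIV_pow]])
  show "(0 * y ^ p - 1 * (real p * y ^ (p - Suc 0))) / (y ^ p * y ^ p) = - real p / y ^ Suc p"
    using assms by (cases p) (simp_all del: of_nat_Suc)
qed (use assms in simp)

text \<open>First-order Taylor expansion of \<open>1 / z ^ n\<close> around \<open>y\<close>, with
  the second derivative bounded by its value at \<open>c\<close>. The quadratic remainder is what
  can later be integrated over a parameter and divided by the increment.\<close>

lemma inverse_power_Taylor_bound:
  fixes y z c :: real
  assumes "c > 0" "y \<ge> c" "z \<ge> c"
  shows "\<bar>1 / z ^ n - 1 / y ^ n + real n * (z - y) / y ^ Suc n\<bar>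
           \<le> real n * (real n + 1) / c ^ (n + 2) * (z - y)\<^sup>2"
proof -
  \<comment> \<open>\<open>f i\<close> is the \<open>i\<close>-th derivative of
    \<open>1 / x ^ n\<close>; the rising factorial collects
    \<open>n (n + 1) ... (n + i - 1)\<close>.\<close>
  define f :: "nat \<Rightarrow> real \<Rightarrow> real"
    where "f = (\<lambda>i x. (- 1) ^ i * pochhammer (real n) i * (1 / x ^ (n + i)))"
  have "norm (f 0 z - (\<Sum>i\<le>1. f i y * (z - y) ^ i / fact i))
          \<le> real n * (real n + 1) / c ^ (n + 2) * norm (z - y) ^ Suc 1 / fact 1"
  proof (rule field_Taylor[where S = "{c..}"])
    fix i :: nat and x :: real assume "x \<in> {c..}"
    hence x: "x > 0" using assms by simp
    show "(f i has_field_derivative f (Suc i) x) (at x within {c..})"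
      unfolding f_def
      by (rule DERIV_cong, rule DERIV_cmult, rule DERIV_inverse_power)
         (use x in \<open>auto simp: pochhammer_Suc field_simps\<close>)
  next
    fix x :: real assume x: "x \<in> {c..}"
    have "c ^ (n + 2) \<le> x ^ (n + 2)" using x assms by (intro power_mono) auto
    hence "real n * (real n + 1) * (1 / x ^ (n + 2)) \<le> real n * (real n + 1) * (1 / c ^ (n + 2))"
      using assms by (intro mult_left_mono divide_left_mono) (use x in auto)
    moreover have "f (Suc 1) x = real n * (real n + 1) * (1 / x ^ (n + 2))"
      by (simp add: f_def pochhammer_Suc)
    moreover have "0 \<le> real n * (real n + 1) * (1 / x ^ (n + 2))"
      using x assms by simp
    ultimately show "norm (f (Suc 1) x) \<le> real n * (real n + 1) / c ^ (n + 2)"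
      by simp
  qed (use assms in auto)
  moreover have "f 0 z - (\<Sum>i\<le>1. f i y * (z - y) ^ i / fact i)
      = 1 / z ^ n - 1 / y ^ n + real n * (z - y) / y ^ Suc n"
    by (simp add: f_def)
  ultimately show ?thesis by (simp add: power2_eq_square)
qed

text \<open>Integrating the pointwise Taylor remainder against the nonnegative weight
  \<open>w\<close> bounds the error of the linear approximation by a constant times
  \<open>h ^ 2\<close>, so the difference quotient converges.\<close>

lemma DERIV_integral_inverse_power:
  fixes w :: "real \<Rightarrow> real"
  assumes int: "\<And>p b. p \<ge> n \<Longrightarrow> b > 0 \<Longrightarrow> (\<lambda>x. w x / (x + b) ^ p) integrable_on {0<..}"
    and w: "\<And>x. x > 0 \<Longrightarrow> 0 \<le> w x" and a: "a > 0"
  shows "((\<lambda>b. integral {0<..} (\<lambda>x. w x / (x + b) ^ n)) has_real_derivative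
           - real n * integral {0<..} (\<lambda>x. w x / (x + a) ^ Suc n)) (at a)"
proof -
  define F where "F = (\<lambda>p b. integral {0<..} (\<lambda>x. w x / (x + b) ^ p))"
  have F: "((\<lambda>x. w x / (x + b) ^ p) has_integral F p b) {0<..}" if "p \<ge> n" "b > 0" for p b
    unfolding F_def using int[OF that] by (rule integrable_integral)
  \<comment> \<open>For \<open>\<bar>h\<bar> < a / 2\<close>, both \<open>x + a\<close> and
    \<open>x + a + h\<close> are at least \<open>x + a / 2\<close>. This is the \<open>c\<close> of
    the Taylor bound, and \<open>K\<close> is the resulting remainder constant integrated against
    \<open>w\<close>.\<close>
  define K where "K = real n * (real n + 1) * F (n + 2) (a / 2)"
  have bound: "\<bar>F n (a + h) - F n a + real n * h * F (Suc n) a\<bar> \<le> K * h\<^sup>2" if h: "\<bar>h\<bar> < a / 2" for h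
  proof -
    have 1: "((\<lambda>x. w x / (x + (a + h)) ^ n - w x / (x + a) ^ n + real n * h * (w x / (x + a) ^ Suc n))
            has_integral (F n (a + h) - F n a + real n * h * F (Suc n) a)) {0<..}"
      using h a by (intro has_integral_add has_integral_diff has_integral_mult_right F) auto
    have 2: "((\<lambda>x. real n * (real n + 1) * h\<^sup>2 * (w x / (x + a / 2) ^ (n + 2)))
            has_integral (real n * (real n + 1) * h\<^sup>2 * F (n + 2) (a / 2))) {0<..}"
      using a by (intro has_integral_mult_right F) auto
    have "norm (integral {0<..} (\<lambda>x. w x / (x + (a + h)) ^ n - w x / (x + a) ^ n + real n * h * (w x / (x + a) ^ Suc n)))
       \<le> integral {0<..} (\<lambda>x. real n * (real n + 1) * h\<^sup>2 * (w x / (x + a / 2) ^ (n + 2)))"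
    proof (rule integral_norm_bound_integral)
      fix x :: real assume "x \<in> {0<..}"
      hence x: "x > 0" by simp
      have "\<bar>1 / (x + (a + h)) ^ n - 1 / (x + a) ^ n + real n * ((x + (a + h)) - (x + a)) / (x + a) ^ Suc n\<bar>
           \<le> real n * (real n + 1) / (x + a / 2) ^ (n + 2) * ((x + (a + h)) - (x + a))\<^sup>2"
        using x a h by (intro inverse_power_Taylor_bound) auto
      hence "w x * \<bar>1 / (x + (a + h)) ^ n - 1 / (x + a) ^ n + real n * h / (x + a) ^ Suc n\<bar>
           \<le> w x * (real n * (real n + 1) / (x + a / 2) ^ (n + 2) * h\<^sup>2)"
        using w[OF x] by (intro mult_left_mono) auto
      moreover have "w x * \<bar>1 / (x + (a + h)) ^ n - 1 / (x + a) ^ n + real n * h / (x + a) ^ Suc n\<bar>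
          = \<bar>w x * (1 / (x + (a + h)) ^ n - 1 / (x + a) ^ n + real n * h / (x + a) ^ Suc n)\<bar>"
        using w[OF x] by (simp add: abs_mult)
      ultimately show "norm (w x / (x + (a + h)) ^ n - w x / (x + a) ^ n + real n * h * (w x / (x + a) ^ Suc n))
         \<le> real n * (real n + 1) * h\<^sup>2 * (w x / (x + a / 2) ^ (n + 2))"
        by (simp add: algebra_simps)
    qed (use 1 2 in \<open>auto simp: has_integral_integrable\<close>)
    thus ?thesis
      using integral_unique[OF 1] integral_unique[OF 2] by (simp add: K_def mult_ac)
  qed
  have "((\<lambda>h. (F n (a + h) - F n a) / h) \<longlongrightarrow> - real n * F (Suc n) a) (at 0)"
  proof (rule Lim_transform_bound[where g = "\<lambda>h. K * h", THEN LIM_zero_cancel])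
    have "\<forall>\<^sub>F h in at (0::real). h \<in> ball 0 (a / 2) \<and> h \<noteq> 0"
      using a by (intro eventually_conj eventually_at_in_open' eventually_neq_at_within) (auto simp: eventually_at_filter)
    thus "\<forall>\<^sub>F h in at 0. norm ((F n (a + h) - F n a) / h - - real n * F (Suc n) a) \<le> norm (K * h)"
    proof eventually_elim
      case (elim h)
      have "(F n (a + h) - F n a) / h - - real n * F (Suc n) a
          = (F n (a + h) - F n a + real n * h * F (Suc n) a) / h"
        using elim by (simp add: field_simps)
      also have "norm \<dots> \<le> K * h\<^sup>2 / \<bar>h\<bar>"
        using bound[of h] elim by (auto simp: dist_norm intro!: divide_right_mono)
      also have "\<dots> = K * \<bar>h\<bar>" using elim by (simp add: power2_eq_square field_simps abs_if)
      also have "\<dots> \<le> norm (K * h)" by (simp add: abs_mult mult_right_mono)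
      finally show ?case .
    qed
    show "((\<lambda>h. K * h) \<longlongrightarrow> 0) (at 0)" by (auto intro!: tendsto_eq_intros)
  qed
  thus ?thesis unfolding DERIV_def F_def .
qed

lemma DERIV_log_kernel_integral:
  assumes "a > 0" "m < n"
  shows "(log_kernel_integral m n has_real_derivative - real n * log_kernel_integral m (Suc n) a) (at a)"
proof -
  \<comment> \<open>The kernel is regrouped so that \<open>x ^ m * (ln x / (x - 1))\<close>, which
    is nonnegative, is the weight.\<close>
  have "((\<lambda>b. integral {0<..} (\<lambda>x. (x ^ m * (ln x / (x - 1))) / (x + b) ^ n)) has_real_derivative
           - real n * integral {0<..} (\<lambda>x. (x ^ m * (ln x / (x - 1))) / (x + a) ^ Suc n)) (at a)"
  proof (rule DERIV_integral_inverse_power[OF _ _ assms(1)])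
    show "(\<lambda>x. (x ^ m * (ln x / (x - 1))) / (x + b) ^ p) integrable_on {0<..}" if "p \<ge> n" "b > 0" for p and b :: real
      using kernel_integrable[of b m p] that assms by simp
    show "0 \<le> x ^ m * (ln x / (x - 1))" if "x > 0" for x :: real
      using ln_over_diff_bounds(1)[OF that] that by (intro mult_nonneg_nonneg) auto
  qed
  thus ?thesis by (simp add: log_kernel_integral_def[abs_def])
qed

lemma log_kernel_integral_Suc:
  assumes "a > 0" "m < n"
  shows "log_kernel_integral (Suc m) (Suc n) a = log_kernel_integral m n a - a * log_kernel_integral m (Suc n) a"
proof -
  have "((\<lambda>x. x ^ m * ln x / ((x - 1) * (x + a) ^ n) - a * (x ^ m * ln x / ((x - 1) * (x + a) ^ Suc n)))
         has_integral (log_kernel_integral m n a - a * log_kernel_integral m (Suc n) a)) {0<..}"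
    unfolding log_kernel_integral_def using assms
    by (intro has_integral_diff has_integral_mult_right integrable_integral kernel_integrable) auto
  hence "((\<lambda>x. x ^ Suc m * ln x / ((x - 1) * (x + a) ^ Suc n))
         has_integral (log_kernel_integral m n a - a * log_kernel_integral m (Suc n) a)) {0<..}"
  proof (rule has_integral_eq[rotated])
    fix x :: real assume "x \<in> {0<..}"
    hence x: "x + a \<noteq> 0" using assms by auto
    define q where "q = x ^ m * ln x / ((x - 1) * (x + a) ^ Suc n)"
    have "x ^ m * ln x / ((x - 1) * (x + a) ^ n) = (x + a) * q"
      using x by (simp add: q_def)
    moreover have "x ^ Suc m * ln x / ((x - 1) * (x + a) ^ Suc n) = x * q"
      by (simp add: q_def)
    ultimately show "x ^ m * ln x / ((x - 1) * (x + a) ^ n) - a * (x ^ m * ln x / ((x - 1) * (x + a) ^ Suc n))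
        = x ^ Suc m * ln x / ((x - 1) * (x + a) ^ Suc n)"
      unfolding q_def[symmetric] by (simp add: algebra_simps)
  qed
  thus ?thesis unfolding log_kernel_integral_def by (rule integral_unique)
qed

section \<open>The sum of the inverse odd squares\<close>

text \<open>Group the series of inverse squares into consecutive pairs. The even member of each pair
  is a quarter of a term of the same series, and
  \<open>pi\<^sup>2 / 6 - pi\<^sup>2 / 24 = pi\<^sup>2 / 8\<close>.\<close>

lemma sums_inverse_odd_squares: "(\<lambda>n. 1 / real (2 * n + 1) ^ 2) sums (pi\<^sup>2 / 8)"
proof -
  note S = inverse_squares_sums
  have "(\<lambda>n. (\<Sum>i = n * 2..<n * 2 + 2. 1 / (real i + 1)\<^sup>2) - 1 / 4 * (1 / (real n + 1)\<^sup>2))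
          sums (pi\<^sup>2 / 6 - 1 / 4 * (pi\<^sup>2 / 6))"
    using S by (intro sums_diff sums_mult sums_group) (auto simp: add_ac)
  also have "(\<lambda>n. (\<Sum>i = n * 2..<n * 2 + 2. 1 / (real i + 1)\<^sup>2) - 1 / 4 * (1 / (real n + 1)\<^sup>2))
             = (\<lambda>n. 1 / real (2 * n + 1) ^ 2)"
  proof
    fix n :: nat
    have "(2 * real n + 2)\<^sup>2 = 4 * (real n + 1)\<^sup>2" by (simp add: power2_eq_square algebra_simps)
    thus "(\<Sum>i = n * 2..<n * 2 + 2. 1 / (real i + 1)\<^sup>2) - 1 / 4 * (1 / (real n + 1)\<^sup>2) = 1 / real (2 * n + 1) ^ 2"
      by (simp add: numeral_2_eq_2 mult_ac add_ac)
  qed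
  finally show ?thesis by simp
qed

section \<open>Iterated derivatives on the positive half-line\<close>

text \<open>Identifies iterated \<open>deriv\<close> with an explicit family of derivatives known
  only for \<open>t > 0\<close>. Since the half-line is open, agreement there is agreement near each
  of its points, which is all that \<open>deriv\<close> sees.\<close>

lemma higher_deriv_eqI:
  fixes f :: "real \<Rightarrow> real"
  assumes D: "\<And>i t. t > 0 \<Longrightarrow> (D i has_real_derivative D (Suc i) t) (at t)"
    and f: "\<And>t. t > 0 \<Longrightarrow> f t = D 0 t" and t: "t > 0"
  shows "(deriv ^^ k) f t = D k t"
  using t
proof (induction k arbitrary: t)
  case 0
  thus ?case using f by simp
next
  case (Suc k)
  have "\<forall>\<^sub>F s in nhds t. s \<in> {0<..}"
    using Suc.prems by (intro eventually_nhds_in_open) auto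
  hence "\<forall>\<^sub>F s in nhds t. (deriv ^^ k) f s = D k s"
    by eventually_elim (use Suc.IH in auto)
  hence "deriv ((deriv ^^ k) f) t = deriv (D k) t"
    by (rule deriv_cong_ev) simp
  thus ?case using D[OF Suc.prems] by (simp add: DERIV_imp_deriv)
qed

text \<open>A class of functions that is closed under differentiation on the positive half-line, so that
  iterated \<open>deriv\<close> never meets its junk value at a point of non-differentiability.\<close>

inductive_set log_rational :: "(real \<Rightarrow> real) set" where
  const: "(\<lambda>_. c) \<in> log_rational"
| ln: "ln \<in> log_rational"
| inverse: "(\<lambda>t. 1 / t) \<in> log_rational"
| inverse_Suc: "(\<lambda>t. 1 / (t + 1)) \<in> log_rational"
| add: "f \<in> log_rational \<Longrightarrow> g \<in> log_rational \<Longrightarrow> (\<lambda>t. f t + g t) \<in> log_rational"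
| mult: "f \<in> log_rational \<Longrightarrow> g \<in> log_rational \<Longrightarrow> (\<lambda>t. f t * g t) \<in> log_rational"

lemma log_rational_power: "f \<in> log_rational \<Longrightarrow> (\<lambda>t. f t ^ n) \<in> log_rational"
proof (induction n)
  case 0
  show ?case using log_rational.const[of 1] by simp
next
  case (Suc n)
  thus ?case using log_rational.mult[of f "\<lambda>t. f t ^ n"] by simp
qed

lemma log_rational_DERIV:
  assumes "f \<in> log_rational"
  shows "\<exists>g\<in>log_rational. \<forall>t>0. (f has_real_derivative g t) (at t)"
  using assms
proof induction
  case (const c)
  show ?case by (rule bexI[OF _ log_rational.const[of 0]]) auto
next
  case ln
  show ?case by (rule bexI[OF _ log_rational.inverse]) (auto intro!: derivative_eq_intros)
next
  case inverse
  show ?case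
    by (rule bexI[OF _ log_rational.mult[OF log_rational.const[of "-1"]
          log_rational.mult[OF log_rational.inverse log_rational.inverse]]])
       (auto intro!: derivative_eq_intros)
next
  case inverse_Suc
  show ?case
    by (rule bexI[OF _ log_rational.mult[OF log_rational.const[of "-1"]
          log_rational.mult[OF log_rational.inverse_Suc log_rational.inverse_Suc]]])
       (auto intro!: derivative_eq_intros)
next
  case (add f g)
  then obtain f' g' where f': "f' \<in> log_rational" "\<And>t. t > 0 \<Longrightarrow> (f has_real_derivative f' t) (at t)"
    and g': "g' \<in> log_rational" "\<And>t. t > 0 \<Longrightarrow> (g has_real_derivative g' t) (at t)"
    by blast
  show ?case
    by (rule bexI[OF _ log_rational.add[OF f'(1) g'(1)]]) (auto intro!: DERIV_add f' g')
next
  case (mult f g)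
  then obtain f' g' where f': "f' \<in> log_rational" "\<And>t. t > 0 \<Longrightarrow> (f has_real_derivative f' t) (at t)"
    and g': "g' \<in> log_rational" "\<And>t. t > 0 \<Longrightarrow> (g has_real_derivative g' t) (at t)"
    by blast
  show ?case
    by (rule bexI[OF _ log_rational.add[OF log_rational.mult[OF f'(1) mult.hyps(2)]
          log_rational.mult[OF g'(1) mult.hyps(1)]]]) (auto intro!: DERIV_mult f' g')
qed

lemma log_rational_higher_deriv:
  assumes "f \<in> log_rational" "t > 0"
  shows "((deriv ^^ k) f has_real_derivative (deriv ^^ Suc k) f t) (at t)"
proof -
  have "\<forall>f\<in>log_rational. \<exists>g. g \<in> log_rational \<and> (\<forall>t>0. (f has_real_derivative g t) (at t))"
    using log_rational_DERIV by blast
  \<comment> \<open>\<open>deriv f\<close> is only known to agree with a member of the class for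
    \<open>t > 0\<close>. Iterating a chosen derivative \<open>nxt\<close> inside the class avoids
    this, and \<open>higher_deriv_eqI\<close> then transfers the result to
    \<open>deriv\<close>.\<close>
  then obtain nxt where nxt: "\<And>f. f \<in> log_rational \<Longrightarrow> nxt f \<in> log_rational"
      "\<And>f t. f \<in> log_rational \<Longrightarrow> t > 0 \<Longrightarrow> (f has_real_derivative nxt f t) (at t)"
    by (auto dest!: bchoice)
  have mem: "(nxt ^^ i) f \<in> log_rational" for i
    by (induction i) (use nxt assms in auto)
  have D: "((nxt ^^ i) f has_real_derivative (nxt ^^ Suc i) f t) (at t)" if "t > 0" for i t
    using nxt(2)[OF mem[of i] that] by simp
  have eq: "(deriv ^^ i) f t = (nxt ^^ i) f t" if "t > 0" for i t
    by (rule higher_deriv_eqI[of "\<lambda>i. (nxt ^^ i) f"]) (use D that in auto)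
  have "((deriv ^^ k) f has_real_derivative (nxt ^^ Suc k) f t) (at t)"
    by (rule has_field_derivative_transform_within_open[OF D[OF assms(2), of k], where S = "{0<..}"])
       (use assms eq in auto)
  thus ?thesis using eq[OF assms(2), of "Suc k"] by simp
qed

lemma ln_power_over_power_log_rational:
  "(\<lambda>t. ln t ^ p / (t + 1) ^ q) \<in> log_rational"
proof -
  have "(\<lambda>t. ln t ^ p * (1 / (t + 1)) ^ q) \<in> log_rational"
    by (intro log_rational.mult log_rational_power log_rational.intros)
  thus ?thesis by (simp add: power_divide)
qed

text \<open>Differentiating \<open>k\<close> times produces \<open>(m + 1) ... (m + k)\<close>; this
  converts it to the factorial and binomial of the final formula.\<close>

lemma pochhammer_eq_fact_binomial:
  "pochhammer (real m + 1) k = fact k * real ((k + m) choose m)"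
proof -
  have "fact m * pochhammer (real m + 1) k = (fact (k + m) :: real)"
  proof (induction k)
    case (Suc k)
    have "fact m * pochhammer (real m + 1) (Suc k) = (fact m * pochhammer (real m + 1) k) * (real m + 1 + real k)"
      by (simp add: pochhammer_Suc)
    thus ?case unfolding Suc.IH by (simp add: algebra_simps)
  qed simp
  thus ?thesis by (simp add: binomial_fact field_simps)
qed

section \<open>Termwise integrals for the geometric expansions on both sides of 1\<close>

lemma has_integral_power_ln_Ioo:
  "((\<lambda>x. - (x ^ p * ln x)) has_integral 1 / real (p + 1) ^ 2) {0<..<1}"
proof -
  let ?F = "\<lambda>x::real. x ^ (p + 1) / real (p + 1) ^ 2 - x ^ (p + 1) * ln x / real (p + 1)"
  have "((\<lambda>x. - (x ^ p * ln x)) has_integral (1 / real (p + 1) ^ 2 - 0)) (einterval (ereal 0) (ereal 1))"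
  proof (rule has_integral_FTC_nonneg(1)[where F = ?F])
    fix x assume "ereal 0 < ereal x" "ereal x < ereal 1"
    hence x: "0 < x" "x < 1" by auto
    have "(?F has_real_derivative real (p + 1) * x ^ (p + 1 - Suc 0) / real (p + 1) ^ 2
        - (real (p + 1) * x ^ (p + 1 - Suc 0) * ln x + 1 / x * x ^ (p + 1)) / real (p + 1)) (at x)"
      using x by (intro DERIV_diff DERIV_cdivide DERIV_mult DERIV_pow)
                 (auto intro!: derivative_eq_intros)
    also have "real (p + 1) * x ^ (p + 1 - Suc 0) / real (p + 1) ^ 2
        - (real (p + 1) * x ^ (p + 1 - Suc 0) * ln x + 1 / x * x ^ (p + 1)) / real (p + 1) = - (x ^ p * ln x)"
      using x by (simp add: add_divide_distrib power2_eq_square)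
    finally show "(?F has_real_derivative - (x ^ p * ln x)) (at x)" .
    show "isCont (\<lambda>x. - (x ^ p * ln x)) x"
      using x by (intro continuous_intros) auto
    show "0 \<le> - (x ^ p * ln x)"
      using x by (simp add: mult_nonneg_nonpos)
  next
    \<comment> \<open>Splitting off one factor,
      \<open>x ^ (p + 1) * ln x = x ^ p * (x * ln x)\<close> reduces the limit at 0 to this
      one.\<close>
    have "((\<lambda>x::real. x * ln x) \<longlongrightarrow> 0) (at_right 0)" by real_asymp
    hence "((\<lambda>x. x ^ (p + 1) / real (p + 1) ^ 2 - x ^ p * (x * ln x) / real (p + 1)) \<longlongrightarrow>
        0 ^ (p + 1) / real (p + 1) ^ 2 - 0 ^ p * 0 / real (p + 1)) (at_right 0)"
      by (intro tendsto_intros) auto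
    thus "((?F \<circ> real_of_ereal) \<longlongrightarrow> 0) (at_right (ereal 0))"
      unfolding ereal_tendsto_simps by (simp add: mult_ac)
  next
    have "(?F \<longlongrightarrow> 1 ^ (p + 1) / real (p + 1) ^ 2 - 1 ^ (p + 1) * ln 1 / real (p + 1)) (at_left 1)"
      by (intro tendsto_intros) auto
    thus "((?F \<circ> real_of_ereal) \<longlongrightarrow> 1 / real (p + 1) ^ 2) (at_left (ereal 1))"
      unfolding ereal_tendsto_simps by simp
  qed simp
  moreover have "einterval (ereal 0) (ereal 1) = {0<..<1}" by (auto simp: einterval_def)
  ultimately show ?thesis by simp
qed

lemma has_integral_power_Ioo: "((\<lambda>x. x ^ p) has_integral 1 / real (p + 1)) {0<..<1}"
proof -
  have "((\<lambda>x. x ^ Suc p / real (Suc p)) has_real_derivative x ^ p) (at x within S)" for x S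
    using DERIV_cdivide[OF DERIV_pow[of "Suc p" x S], of "real (Suc p)"] by (simp del: of_nat_Suc)
  hence "((\<lambda>x. x ^ p) has_integral (1 ^ Suc p / real (Suc p) - 0 ^ Suc p / real (Suc p))) {0..1}"
    by (intro fundamental_theorem_of_calculus)
       (auto simp: has_real_derivative_iff_has_vector_derivative[symmetric] simp del: of_nat_Suc)
  thus ?thesis by (simp add: has_integral_Icc_iff_Ioo)
qed

text \<open>The mirror image of \<open>has_integral_power_ln_Ioo\<close> under
  \<open>x \<mapsto> 1 / x\<close>, hence the same value; proved directly from the antiderivative
  found by parts.\<close>

lemma has_integral_ln_over_power_Ioi:
  "((\<lambda>x. ln x / x ^ (p + 2)) has_integral 1 / real (p + 1) ^ 2) {1<..}"
proof -
  let ?F = "\<lambda>x::real. - (ln x * (1 / x ^ (p + 1)) / real (p + 1)) - 1 / x ^ (p + 1) / real (p + 1) ^ 2"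
  have "((\<lambda>x. ln x / x ^ (p + 2)) has_integral (0 - (- 1 / real (p + 1) ^ 2))) (einterval (ereal 1) \<infinity>)"
  proof (rule has_integral_FTC_nonneg(1)[where F = ?F])
    fix x assume "ereal 1 < ereal x"
    hence x: "1 < x" by auto
    have "(?F has_real_derivative
       - ((1 / x * (1 / x ^ (p + 1)) + - real (p + 1) / x ^ Suc (p + 1) * ln x) / real (p + 1))
       - - real (p + 1) / x ^ Suc (p + 1) / real (p + 1) ^ 2) (at x)"
      using x by (intro DERIV_diff DERIV_minus DERIV_cdivide DERIV_mult DERIV_inverse_power)
                 (auto intro!: derivative_eq_intros)
    also have "- ((1 / x * (1 / x ^ (p + 1)) + - real (p + 1) / x ^ Suc (p + 1) * ln x) / real (p + 1))
       - - real (p + 1) / x ^ Suc (p + 1) / real (p + 1) ^ 2 = ln x / x ^ (p + 2)"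
      using x by (simp add: divide_simps power2_eq_square) (simp add: algebra_simps)?
    finally show "(?F has_real_derivative ln x / x ^ (p + 2)) (at x)" .
    show "isCont (\<lambda>x. ln x / x ^ (p + 2)) x"
      using x by (intro continuous_intros) auto
    show "0 \<le> ln x / x ^ (p + 2)"
      using x by simp
  next
    have "(?F \<longlongrightarrow> - (ln 1 * (1 / 1 ^ (p + 1)) / real (p + 1)) - 1 / 1 ^ (p + 1) / real (p + 1) ^ 2) (at_right 1)"
      by (intro tendsto_intros) auto
    thus "((?F \<circ> real_of_ereal) \<longlongrightarrow> - 1 / real (p + 1) ^ 2) (at_right (ereal 1))"
      unfolding ereal_tendsto_simps by simp
  next
    have "((\<lambda>x::real. ln x / x) \<longlongrightarrow> 0) at_top" by real_asymp
    moreover have "((\<lambda>x::real. 1 / x) \<longlongrightarrow> 0) at_top" by real_asymp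
    ultimately have "((\<lambda>x. - ((ln x / x) * (1 / x) ^ p / real (p + 1)) - (1 / x) ^ (p + 1) / real (p + 1) ^ 2) \<longlongrightarrow>
       - (0 * 0 ^ p / real (p + 1)) - 0 ^ (p + 1) / real (p + 1) ^ 2) at_top"
      by (intro tendsto_intros) auto
    thus "((?F \<circ> real_of_ereal) \<longlongrightarrow> 0) (at_left \<infinity>)"
      unfolding ereal_tendsto_simps by (simp add: power_divide)
  qed simp
  moreover have "einterval (ereal 1) \<infinity> = {1<..}" by (auto simp: einterval_def)
  ultimately show ?thesis by simp
qed

lemma has_integral_inverse_power_Ioi:
  "((\<lambda>x::real. 1 / x ^ (p + 2)) has_integral 1 / real (p + 1)) {1<..}"
proof -
  let ?F = "\<lambda>x::real. - (1 / x ^ (p + 1) / real (p + 1))"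
  have "((\<lambda>x. 1 / x ^ (p + 2)) has_integral (0 - (- 1 / real (p + 1)))) (einterval (ereal 1) \<infinity>)"
  proof (rule has_integral_FTC_nonneg(1)[where F = ?F])
    fix x assume "ereal 1 < ereal x"
    hence x: "1 < x" by auto
    have "(?F has_real_derivative - (- real (p + 1) / x ^ Suc (p + 1) / real (p + 1))) (at x)"
      using x by (intro DERIV_minus DERIV_cdivide DERIV_inverse_power) auto
    also have "- (- real (p + 1) / x ^ Suc (p + 1) / real (p + 1)) = 1 / x ^ (p + 2)"
      by (simp del: of_nat_Suc of_nat_add)
    finally show "(?F has_real_derivative 1 / x ^ (p + 2)) (at x)" .
    show "isCont (\<lambda>x. 1 / x ^ (p + 2)) x"
      using x by (intro continuous_intros) auto
    show "0 \<le> 1 / x ^ (p + 2)"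
      using x by simp
  next
    have "(?F \<longlongrightarrow> - (1 / 1 ^ (p + 1) / real (p + 1))) (at_right 1)"
      by (intro tendsto_intros) auto
    thus "((?F \<circ> real_of_ereal) \<longlongrightarrow> - 1 / real (p + 1)) (at_right (ereal 1))"
      unfolding ereal_tendsto_simps by simp
  next
    have "((\<lambda>x::real. 1 / x) \<longlongrightarrow> 0) at_top" by real_asymp
    hence "((\<lambda>x. - ((1 / x) ^ (p + 1) / real (p + 1))) \<longlongrightarrow> - (0 ^ (p + 1) / real (p + 1))) at_top"
      by (intro tendsto_intros) auto
    thus "((?F \<circ> real_of_ereal) \<longlongrightarrow> 0) (at_left \<infinity>)"
      unfolding ereal_tendsto_simps by (simp add: power_divide)
  qed simp
  moreover have "einterval (ereal 1) \<infinity> = {1<..}" by (auto simp: einterval_def)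
  ultimately show ?thesis by simp
qed

text \<open>Integrating the pointwise remainder bound \<open>r N\<close> shows that the integral
  differs from the partial sum of the \<open>c n\<close> by at most \<open>e N\<close>. Partial sums
  start with one term (\<open>Suc N\<close>) so that, in the application on \<open>(0, 1)\<close>,
  even the first remainder bound is integrable at 0.\<close>

lemma has_integral_by_sums:
  fixes f :: "real \<Rightarrow> real"
  assumes f: "f integrable_on S"
    and g: "\<And>n. (g n has_integral c n) S" and r: "\<And>n. (r n has_integral e n) S"
    and bound: "\<And>N x. x \<in> S \<Longrightarrow> \<bar>f x - (\<Sum>n<Suc N. g n x)\<bar> \<le> r N x"
    and e: "e \<longlonglongrightarrow> 0" and c: "c sums C"
  shows "(f has_integral C) S"
proof -
  have "\<bar>integral S f - (\<Sum>n<Suc N. c n)\<bar> \<le> e N" for N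
  proof -
    have 1: "((\<lambda>x. f x - (\<Sum>n<Suc N. g n x)) has_integral (integral S f - (\<Sum>n<Suc N. c n))) S"
      using f g by (intro has_integral_diff has_integral_sum integrable_integral) auto
    have "norm (integral S (\<lambda>x. f x - (\<Sum>n<Suc N. g n x))) \<le> integral S (r N)"
      using 1 r[of N] bound by (intro integral_norm_bound_integral) (auto simp: has_integral_integrable)
    thus ?thesis using integral_unique[OF 1] integral_unique[OF r[of N]] by simp
  qed
  hence "(\<lambda>N. integral S f - (\<Sum>n<Suc N. c n)) \<longlonglongrightarrow> 0"
    by (intro Lim_null_comparison[OF _ e] always_eventually) auto
  moreover have "(\<lambda>N. integral S f - (\<Sum>n<Suc N. c n)) \<longlonglongrightarrow> integral S f - C"
    using c unfolding sums_def by (intro tendsto_diff tendsto_const) (rule LIMSEQ_Suc)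
  ultimately have "integral S f - C = 0" by (rule LIMSEQ_unique[rotated])
  thus ?thesis using f by (metis eq_iff_diff_eq_0 integrable_integral)
qed

section \<open>The integral for \<open>m = 0\<close> and \<open>n = 1\<close>\<close>

lemma log_kernel_integral_at_one: "log_kernel_integral 0 1 1 = pi\<^sup>2 / 4"
proof -
  define f :: "real \<Rightarrow> real" where "f = (\<lambda>x. ln x / ((x - 1) * (x + 1)))"
  have "set_integrable lborel {0<..} f"
    using kernel_integrable_lborel[of 1 0 1] by (simp add: f_def)
  \<comment> \<open>Absolute integrability allows restriction to measurable subsets, here to the two
    sides of 1.\<close>
  hence int: "f integrable_on S" if "S \<subseteq> {0<..}" "S \<in> sets lborel" for S
    using set_integrable_subset[of lborel "{0<..}" f S] that
    by (intro set_borel_integral_eq_integral(1)) auto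
  have f_bounds: "0 \<le> f x" "f x \<le> 1 / sqrt x / (x + 1)" if x: "x > 0" for x
  proof -
    have "f x = ln x / (x - 1) / (x + 1)" by (simp add: f_def)
    thus "0 \<le> f x" "f x \<le> 1 / sqrt x / (x + 1)"
      using ln_over_diff_bounds[OF x] x by (auto intro!: divide_right_mono simp del: divide_divide_eq_left)
  qed
  have "(f has_integral (pi\<^sup>2 / 8)) {0<..<1}"
  proof (rule has_integral_by_sums[OF int])
    show "((\<lambda>x. - (x ^ (2 * n) * ln x)) has_integral 1 / real (2 * n + 1) ^ 2) {0<..<1}" for n
      by (rule has_integral_power_ln_Ioo)
    show "((\<lambda>x. x ^ (2 * n + 1)) has_integral 1 / real (2 * n + 1 + 1)) {0<..<1}" for n
      by (rule has_integral_power_Ioo)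
    show "(\<lambda>n. 1 / real (2 * n + 1 + 1)) \<longlonglongrightarrow> 0" by real_asymp
    show "(\<lambda>n. 1 / real (2 * n + 1) ^ 2) sums (pi\<^sup>2 / 8)" by (rule sums_inverse_odd_squares)
    fix N and x :: real assume "x \<in> {0<..<1}"
    hence x: "0 < x" "x < 1" by auto
    have "x\<^sup>2 \<noteq> 1" using x by (simp add: power2_eq_1_iff)
    hence geo: "(\<Sum>n<Suc N. x ^ (2 * n)) = (1 - x ^ (2 * Suc N)) / (1 - x\<^sup>2)"
      using sum_gp_strict[of "x\<^sup>2" "Suc N"] unfolding power_mult by (simp del: sum.lessThan_Suc power_Suc)
    have "f x - (\<Sum>n<Suc N. - (x ^ (2 * n) * ln x)) = f x + ln x * (\<Sum>n<Suc N. x ^ (2 * n))"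
      unfolding sum_distrib_left by (simp add: sum_negf mult_ac)
    \<comment> \<open>The tail of the geometric expansion of \<open>f\<close> is \<open>f\<close>
      itself times the first omitted power.\<close>
    also have "\<dots> = x ^ (2 * Suc N) * f x"
    proof -
      have "f x = - (ln x / (1 - x\<^sup>2))"
        using minus_divide_right[of "ln x" "1 - x\<^sup>2"] by (simp add: f_def power2_eq_square algebra_simps)
      moreover have "f x + ln x * (\<Sum>n<Suc N. x ^ (2 * n)) = f x + (1 - x ^ (2 * Suc N)) * (ln x / (1 - x\<^sup>2))"
        unfolding geo by (simp add: mult_ac)
      ultimately show ?thesis by (simp add: algebra_simps)
    qed
    finally have eq: "f x - (\<Sum>n<Suc N. - (x ^ (2 * n) * ln x)) = x ^ (2 * Suc N) * f x" .
    \<comment> \<open>On \<open>(0, 1)\<close> this gives \<open>f x \<le> 1 / x\<close>, a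
      singularity that one factor of the omitted power absorbs.\<close>
    have "x \<le> sqrt x" using x by (intro real_le_rsqrt) (simp add: power2_eq_square)
    hence "1 / sqrt x / (x + 1) \<le> 1 / x / 1"
      using x by (intro frac_le) (auto simp: field_simps)
    hence "f x \<le> 1 / x" using f_bounds[OF x(1)] by simp
    hence "x ^ (2 * Suc N) * f x \<le> x ^ (2 * Suc N) * (1 / x)"
      using x by (intro mult_left_mono) auto
    also have "\<dots> = x ^ (2 * N + 1)" using x by simp
    finally show "\<bar>f x - (\<Sum>n<Suc N. - (x ^ (2 * n) * ln x))\<bar> \<le> x ^ (2 * N + 1)"
      unfolding eq using x f_bounds[OF x(1)] by (simp add: abs_mult)
  qed auto
  moreover have "(f has_integral (pi\<^sup>2 / 8)) {1<..}"
  proof (rule has_integral_by_sums[OF int])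
    show "((\<lambda>x. ln x / x ^ (2 * n + 2)) has_integral 1 / real (2 * n + 1) ^ 2) {1<..}" for n
      by (rule has_integral_ln_over_power_Ioi)
    show "((\<lambda>x. 1 / x ^ (2 * n + 2)) has_integral 1 / real (2 * n + 1)) {1::real<..}" for n
      by (rule has_integral_inverse_power_Ioi)
    show "(\<lambda>n. 1 / real (2 * n + 1)) \<longlonglongrightarrow> 0" by real_asymp
    show "(\<lambda>n. 1 / real (2 * n + 1) ^ 2) sums (pi\<^sup>2 / 8)" by (rule sums_inverse_odd_squares)
    fix N and x :: real assume "x \<in> {1<..}"
    hence x: "1 < x" "0 < x" by auto
    \<comment> \<open>Beyond 1 the expansion runs in powers of \<open>1 / x\<close>:
      \<open>f x = u ^ 2 * ln x / (1 - u ^ 2)\<close>.\<close>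
    define u where "u = 1 / x"
    have u: "0 < u" "u < 1" using x by (auto simp: u_def)
    have "u\<^sup>2 \<noteq> 1" using u by (simp add: power2_eq_1_iff)
    hence geo: "(\<Sum>n<Suc N. u ^ (2 * n)) = (1 - u ^ (2 * Suc N)) / (1 - u\<^sup>2)"
      using sum_gp_strict[of "u\<^sup>2" "Suc N"] unfolding power_mult by (simp del: sum.lessThan_Suc power_Suc)
    have "(\<Sum>n<Suc N. ln x / x ^ (2 * n + 2)) = u\<^sup>2 * ln x * (\<Sum>n<Suc N. u ^ (2 * n))"
      unfolding sum_distrib_left by (intro sum.cong) (auto simp: u_def power_divide power_add power2_eq_square)
    also have "\<dots> = (1 - u ^ (2 * Suc N)) * (u\<^sup>2 * ln x / (1 - u\<^sup>2))"
      unfolding geo by simp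
    also have "u\<^sup>2 * ln x / (1 - u\<^sup>2) = f x"
      using x less_1_mult[of x x] by (simp add: f_def u_def divide_simps power2_eq_square) (simp add: algebra_simps)?
    finally have eq: "f x - (\<Sum>n<Suc N. ln x / x ^ (2 * n + 2)) = u ^ (2 * Suc N) * f x"
      by (simp add: algebra_simps)
    have "1 / sqrt x / (x + 1) \<le> 1 / 1 / 1"
      using x by (intro frac_le) auto
    hence "f x \<le> 1" using f_bounds[OF x(2)] by simp
    hence "u ^ (2 * Suc N) * f x \<le> u ^ (2 * Suc N) * 1"
      using u by (intro mult_left_mono) auto
    thus "\<bar>f x - (\<Sum>n<Suc N. ln x / x ^ (2 * n + 2))\<bar> \<le> 1 / x ^ (2 * N + 2)"
      unfolding eq using u f_bounds[OF x(2)] by (simp add: abs_mult u_def power_divide)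
  qed auto
  moreover have "{0<..<1} \<inter> {1<..} = ({} :: real set)" by auto
  ultimately have "(f has_integral (pi\<^sup>2 / 8 + pi\<^sup>2 / 8)) ({0<..<1} \<union> {1<..})"
    by (intro has_integral_Un) simp_all
  moreover have "(f has_integral I) ({0<..<1} \<union> {1<..}) \<longleftrightarrow> (f has_integral I) {0<..}" for I
    by (intro has_integral_spike_set_eq negligible_subset[OF negligible_sing[of 1]]) auto
  ultimately have "(f has_integral (pi\<^sup>2 / 4)) {0<..}" by simp
  thus ?thesis by (simp add: log_kernel_integral_def f_def integral_unique)
qed

text \<open>In the difference the factor \<open>x - 1\<close> cancels, leaving
  \<open>ln x / (x + a) ^ 2\<close>, which has an elementary antiderivative.\<close>

lemma log_kernel_integral_1_2_minus_0_2:
  assumes a: "a > 0"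
  shows "log_kernel_integral 1 2 a - log_kernel_integral 0 2 a = ln a / a"
proof -
  let ?f = "\<lambda>x. ln x / (x + a)\<^sup>2" and ?F = "\<lambda>x. x * ln x / (a * (x + a)) - ln (x + a) / a"
  \<comment> \<open>Also true at \<open>x = 1\<close>: the left side is 0 by division by zero, the
    right side because \<open>ln 1 = 0\<close>.\<close>
  have eq: "x ^ 1 * ln x / ((x - 1) * (x + a) ^ 2) - x ^ 0 * ln x / ((x - 1) * (x + a) ^ 2) = ?f x" for x
  proof (cases "x = 1")
    case False
    have "x ^ 1 * ln x / ((x - 1) * (x + a) ^ 2) - x ^ 0 * ln x / ((x - 1) * (x + a) ^ 2)
        = ((x - 1) * ln x) / ((x - 1) * (x + a) ^ 2)"
      by (simp add: diff_divide_distrib left_diff_distrib)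
    also have "\<dots> = ?f x" using False by simp
    finally show ?thesis .
  qed simp
  have int: "set_integrable lborel {0<..} ?f"
    using set_integral_diff(1)[OF kernel_integrable_lborel[OF a, of 1 2] kernel_integrable_lborel[OF a, of 0 2]]
    unfolding eq by simp
  have einterval: "einterval (ereal 0) \<infinity> = {0<..}" by (auto simp: einterval_def)
  \<comment> \<open>The integrand changes sign, so the integrable form of the fundamental theorem is
    used. \<open>?F\<close> comes from integration by parts with \<open>x / (a * (x + a))\<close>,
    the antiderivative of \<open>1 / (x + a) ^ 2\<close> that vanishes at 0 and so cancels the
    singularity of \<open>ln x\<close>.\<close>
  have "(LBINT x=ereal 0..\<infinity>. ?f x) = 0 - (- ln a / a)"
  proof (rule interval_integral_FTC_integrable[where F = ?F])
    fix x assume "ereal 0 < ereal x"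
    hence x: "x > 0" by simp
    have "(?F has_real_derivative
       ((1 * ln x + 1 / x * x) * (a * (x + a)) - x * ln x * a) / (a * (x + a) * (a * (x + a))) - 1 / (x + a) / a) (at x)"
      using x a by (auto intro!: derivative_eq_intros simp: power2_eq_square)
    also have "((1 * ln x + 1 / x * x) * (a * (x + a)) - x * ln x * a) / (a * (x + a) * (a * (x + a))) - 1 / (x + a) / a = ?f x"
    proof -
      have "x + a \<noteq> 0" using x a by simp
      thus ?thesis using x a by (simp add: divide_simps power2_eq_square) (simp add: algebra_simps)
    qed
    finally show "(?F has_vector_derivative ?f x) (at x)"
      by (simp add: has_real_derivative_iff_has_vector_derivative)
    show "isCont ?f x" using x a by (intro continuous_intros) auto
  next
    show "set_integrable lborel (einterval (ereal 0) \<infinity>) ?f" using int einterval by simp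
  next
    have "((\<lambda>x::real. x * ln x) \<longlongrightarrow> 0) (at_right 0)" by real_asymp
    hence "(?F \<longlongrightarrow> 0 / (a * (0 + a)) - ln (0 + a) / a) (at_right 0)"
      using a by (intro tendsto_intros) auto
    thus "((?F \<circ> real_of_ereal) \<longlongrightarrow> - ln a / a) (at_right (ereal 0))"
      unfolding ereal_tendsto_simps by simp
  next
    have "(?F \<longlongrightarrow> 0) at_top" using a by real_asymp
    thus "((?F \<circ> real_of_ereal) \<longlongrightarrow> 0) (at_left \<infinity>)"
      unfolding ereal_tendsto_simps .
  qed simp
  hence "integral {0<..} ?f = ln a / a"
    using set_borel_integral_eq_integral(2)[OF int] einterval
    by (simp add: interval_lebesgue_integral_le_eq)
  moreover have "((\<lambda>x. x ^ 1 * ln x / ((x - 1) * (x + a) ^ 2) - x ^ 0 * ln x / ((x - 1) * (x + a) ^ 2))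
       has_integral (log_kernel_integral 1 2 a - log_kernel_integral 0 2 a)) {0<..}"
    unfolding log_kernel_integral_def using a
    by (intro has_integral_diff integrable_integral kernel_integrable) auto
  ultimately show ?thesis unfolding eq by (simp add: integral_unique)
qed

lemma log_kernel_integral_0_1:
  assumes a: "a > 0"
  shows "log_kernel_integral 0 1 a = (pi\<^sup>2 + (ln a)\<^sup>2) / (2 * (a + 1))"
proof -
  \<comment> \<open>\<open>(a + 1) / ((x - 1) (x + a)) = 1 / (x - 1) - 1 / (x + a)\<close>, and only the last term depends on \<open>a\<close>.\<close>
  define g where "g = (\<lambda>t. (t + 1) * log_kernel_integral 0 1 t - (ln t)\<^sup>2 / 2)"
  have "\<exists>c. \<forall>t\<in>{0<..}. g t = c"
  proof (rule has_field_derivative_zero_constant)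
    fix t :: real assume "t \<in> {0<..}"
    hence t: "t > 0" by simp
    have "(g has_real_derivative (1 * log_kernel_integral 0 1 t + (- real 1 * log_kernel_integral 0 (Suc 1) t) * (t + 1)
        - 2 * ln t * (1 / t) / 2)) (at t)"
      unfolding g_def
      by (intro DERIV_diff DERIV_mult DERIV_log_kernel_integral DERIV_cdivide)
         (use t in \<open>auto intro!: derivative_eq_intros\<close>)
    \<comment> \<open>The recurrence gives \<open>I 0 1 - t * I 0 2 = I 1 2\<close>, so the first
      two summands amount to \<open>I 1 2 - I 0 2 = ln t / t\<close>.\<close>
    also have "1 * log_kernel_integral 0 1 t + (- real 1 * log_kernel_integral 0 (Suc 1) t) * (t + 1)
        - 2 * ln t * (1 / t) / 2 = 0"
      using log_kernel_integral_1_2_minus_0_2[OF t] log_kernel_integral_Suc[OF t, of 0 1]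
      by (simp add: numeral_2_eq_2 algebra_simps)
    finally show "(g has_real_derivative 0) (at t within {0<..})"
      by (rule has_field_derivative_at_within)
  qed simp
  hence "g a = g 1" using a by auto
  hence "(a + 1) * log_kernel_integral 0 1 a = (pi\<^sup>2 + (ln a)\<^sup>2) / 2"
    using log_kernel_integral_at_one by (simp add: g_def add_divide_distrib)
  thus ?thesis using a by (simp add: field_simps)
qed

section \<open>Closed form for \<open>n = m + 1\<close>\<close>

text \<open>Eliminating \<open>I m (m + 2)\<close> between the two relations gives
  \<open>I (m + 1) (m + 2) = \<Phi> m t + t * \<Phi>' / (m + 1)\<close>, where
  \<open>\<Phi> m\<close> is the closed form and \<open>\<Phi>'\<close> its derivative at
  \<open>t\<close>. The induction step then compares coefficients of powers of
  \<open>1 / (t + 1)\<close>.\<close>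

lemma log_kernel_integral_closed_form:
  assumes "t > 0"
  shows "log_kernel_integral m (Suc m) t = (pi\<^sup>2 + (ln t)\<^sup>2) / 2 * (1 / (t + 1) ^ Suc m)
     + (\<Sum>j<m. (harm (m - j - 1) + ln t) / real (m - j) * (1 / (t + 1) ^ Suc j))"
  using assms
proof (induction m arbitrary: t)
  case 0
  thus ?case using log_kernel_integral_0_1[of t] by simp
next
  case (Suc m)
  define C where "C = (\<lambda>d (t::real). (harm (d - 1) + ln t) / real d)"
  define \<Phi> where "\<Phi> = (\<lambda>m t. (pi\<^sup>2 + (ln t)\<^sup>2) / 2 * (1 / (t + 1) ^ Suc m)
       + (\<Sum>j<m. C (m - j) t * (1 / (t + 1) ^ Suc j)))"
  note t = \<open>t > 0\<close>
  define u where "u = 1 / (t + 1)"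
  define P where "P = (pi\<^sup>2 + (ln t)\<^sup>2) / 2"
  have u_pow: "1 / (t + 1) ^ p = u ^ p" for p by (simp add: u_def power_divide)
  have u_pow': "- real p / (t + 1) ^ Suc p = - real p * u ^ Suc p" for p
    by (simp add: u_def power_divide)
  \<comment> \<open>Since \<open>t * u = 1 - u\<close>, the factor \<open>t\<close> multiplying
    \<open>\<Phi>'\<close> can be traded for powers of \<open>u\<close>.\<close>
  have tu: "t * u ^ Suc p = u ^ p - u ^ Suc p" for p
  proof -
    have "t * u = 1 - u" using t by (simp add: u_def field_simps)
    hence "t * u * u ^ p = (1 - u) * u ^ p" by simp
    thus ?thesis by (simp add: algebra_simps)
  qed
  have IH: "log_kernel_integral m (Suc m) s = \<Phi> m s" if "s > 0" for s
    using Suc.IH[OF that] by (simp add: \<Phi>_def C_def)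
  have dpow: "((\<lambda>t. 1 / (t + 1) ^ p) has_real_derivative - real p * u ^ Suc p) (at t)" for p
    using DERIV_shift[of "\<lambda>t. 1 / t ^ p" "- real p * u ^ Suc p" t 1] t DERIV_inverse_power[of "t + 1" p UNIV] u_pow'[of p]
    by (simp add: add_ac)
  define \<Phi>' where "\<Phi>' = ln t / t * u ^ Suc m + (- real (Suc m) * u ^ Suc (Suc m)) * P
     + (\<Sum>j<m. (1 / t) / real (m - j) * u ^ Suc j + (- real (Suc j) * u ^ Suc (Suc j)) * C (m - j) t)"
  have dln: "((\<lambda>t. (pi\<^sup>2 + (ln t)\<^sup>2) / 2) has_real_derivative ln t / t) (at t)"
    using t by (auto intro!: derivative_eq_intros)
  have dC: "(C d has_real_derivative (1 / t) / real d) (at t)" for d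
    unfolding C_def using t by (intro DERIV_cdivide) (auto intro!: derivative_eq_intros)
  have "(\<Phi> m has_real_derivative (ln t / t * (1 / (t + 1) ^ Suc m) + (- real (Suc m) * u ^ Suc (Suc m)) * P
     + (\<Sum>j<m. (1 / t) / real (m - j) * (1 / (t + 1) ^ Suc j) + (- real (Suc j) * u ^ Suc (Suc j)) * C (m - j) t))) (at t)"
    unfolding \<Phi>_def P_def by (intro DERIV_add DERIV_mult DERIV_sum dln dC dpow)
  hence "(\<Phi> m has_real_derivative \<Phi>') (at t)"
    unfolding u_pow \<Phi>'_def .
  moreover have "(\<Phi> m has_real_derivative - real (Suc m) * log_kernel_integral m (Suc (Suc m)) t) (at t)"
    using DERIV_log_kernel_integral[OF t, of m "Suc m"]
    by (rule has_field_derivative_transform_within_open[where S = "{0<..}"]) (use t IH in auto)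
  ultimately have \<Phi>': "\<Phi>' = - real (Suc m) * log_kernel_integral m (Suc (Suc m)) t"
    by (rule DERIV_unique)
  have "log_kernel_integral (Suc m) (Suc (Suc m)) t
      = log_kernel_integral m (Suc m) t - t * log_kernel_integral m (Suc (Suc m)) t"
    using t by (rule log_kernel_integral_Suc) simp
  hence *: "log_kernel_integral (Suc m) (Suc (Suc m)) t = \<Phi> m t + t * \<Phi>' / real (Suc m)"
    unfolding \<Phi>' by (simp add: IH[OF t] del: of_nat_Suc)
  have t\<Phi>': "t * \<Phi>' = ln t * u ^ Suc m - real (Suc m) * P * (u ^ Suc m - u ^ Suc (Suc m))
     + (\<Sum>j<m. 1 / real (m - j) * u ^ Suc j - real (Suc j) * C (m - j) t * (u ^ Suc j - u ^ Suc (Suc j)))"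
  proof -
    have 1: "t * (ln t / t * X) = ln t * X" "t * ((1 / t) / d * X) = 1 / d * X" for d X
      using t by simp_all
    have 2: "t * ((- r * u ^ Suc p) * Y) = - (r * Y * (u ^ p - u ^ Suc p))" for r p Y
      unfolding tu[symmetric] by (simp only: mult_minus_left mult_minus_right mult_ac)
    show ?thesis unfolding \<Phi>'_def distrib_left sum_distrib_left 1 2 by simp
  qed
  \<comment> \<open>The index moves up by one; the new \<open>j = 0\<close> term vanishes through
    its factor \<open>j\<close>.\<close>
  have shift: "(\<Sum>j<m. real (Suc j) * C (m - j) t * u ^ Suc (Suc j)) = (\<Sum>j<Suc m. real j * C (Suc m - j) t * u ^ Suc j)"
    by (subst sum.lessThan_Suc_shift) simp
  \<comment> \<open>With \<open>m - j = Suc d\<close>, the left side is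
    \<open>harm d + ln t + 1 / Suc d\<close>, so this is the recurrence of the harmonic
    numbers.\<close>
  have coeff: "real (Suc m) * C (m - j) t + 1 / real (m - j) - real (Suc j) * C (m - j) t
      = real (Suc m - j) * C (Suc m - j) t" if "j < m" for j
  proof -
    define d where "d = m - Suc j"
    have m: "m = Suc (d + j)" using that by (simp add: d_def)
    have "real (Suc m) * C (m - j) t + 1 / real (m - j) - real (Suc j) * C (m - j) t
        = real (Suc d) * C (Suc d) t + 1 / real (Suc d)"
      by (simp add: m algebra_simps)
    also have "\<dots> = harm (Suc d) + ln t"
      by (simp add: C_def harm_Suc inverse_eq_divide del: of_nat_Suc)
    also have "\<dots> = real (Suc m - j) * C (Suc m - j) t"
      by (simp add: C_def m del: of_nat_Suc)
    finally show ?thesis .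
  qed
  have "real (Suc m) * \<Phi> m t + t * \<Phi>' = ln t * u ^ Suc m + real (Suc m) * P * u ^ Suc (Suc m)
     + (\<Sum>j<m. (real (Suc m) * C (m - j) t + 1 / real (m - j) - real (Suc j) * C (m - j) t) * u ^ Suc j)
     + (\<Sum>j<m. real (Suc j) * C (m - j) t * u ^ Suc (Suc j))"
    unfolding t\<Phi>' \<Phi>_def u_pow P_def[symmetric]
    by (simp add: algebra_simps sum.distrib sum_subtractf sum_distrib_left)
  also have "(\<Sum>j<m. (real (Suc m) * C (m - j) t + 1 / real (m - j) - real (Suc j) * C (m - j) t) * u ^ Suc j)
      = (\<Sum>j<m. real (Suc m - j) * C (Suc m - j) t * u ^ Suc j)"
    using coeff by (intro sum.cong) auto
  \<comment> \<open>The isolated \<open>ln t * u ^ Suc m\<close> is the \<open>j = m\<close> term of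
    the extended sum, because \<open>C 1 t = ln t\<close> (\<open>harm 0 = 0\<close>).\<close>
  also have "ln t * u ^ Suc m + real (Suc m) * P * u ^ Suc (Suc m) + \<dots>
      + (\<Sum>j<m. real (Suc j) * C (m - j) t * u ^ Suc (Suc j))
      = real (Suc m) * P * u ^ Suc (Suc m) + (\<Sum>j<Suc m. real (Suc m - j) * C (Suc m - j) t * u ^ Suc j)
      + (\<Sum>j<Suc m. real j * C (Suc m - j) t * u ^ Suc j)"
    unfolding shift by (simp add: C_def harm_def)
  \<comment> \<open>The weights \<open>Suc m - j\<close> and \<open>j\<close> add up to
    \<open>Suc m\<close>, the factor to be divided out.\<close>
  also have "\<dots> = real (Suc m) * P * u ^ Suc (Suc m) + (\<Sum>j<Suc m. real (Suc m) * (C (Suc m - j) t * u ^ Suc j))"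
  proof -
    have "real (Suc m - j) * C (Suc m - j) t * u ^ Suc j + real j * C (Suc m - j) t * u ^ Suc j
        = real (Suc m) * (C (Suc m - j) t * u ^ Suc j)" if "j < Suc m" for j
      using that by (simp add: of_nat_diff algebra_simps)
    thus ?thesis unfolding add.assoc sum.distrib[symmetric] by (simp cong: sum.cong_simp)
  qed
  also have "\<dots> = real (Suc m) * \<Phi> (Suc m) t"
    unfolding \<Phi>_def u_pow P_def[symmetric] sum_distrib_left[symmetric] by (simp only: distrib_left mult.assoc)
  finally have "\<Phi> m t + t * \<Phi>' / real (Suc m) = \<Phi> (Suc m) t"
    by (simp add: field_simps)
  thus ?case unfolding * \<Phi>_def C_def by simp
qed

section \<open>Differentiating the closed form \<open>k\<close> times in \<open>a\<close>\<close>

theorem theorem13: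
  fixes m k :: nat and a :: real
  assumes "a > 0"
  shows "((\<lambda>x::real. x ^ m * ln x / ((x - 1) * (x + a) ^ (k + m + 1))) has_integral
      (pi ^ 2 / (2 * (a + 1) ^ (k + m + 1))
       + (- 1) ^ k / (2 * fact k * real ((k + m) choose m))
           * (deriv ^^ k) (\<lambda>t::real. (ln t) ^ 2 / (t + 1) ^ (m + 1)) a
       + (\<Sum>j<m. real ((k + j) choose j) / real ((k + m) choose m)
           * (harm (m - j - 1) / real (m - j)) * (1 / (a + 1) ^ (j + k + 1)))
       + (- 1) ^ k / (fact k * real ((k + m) choose m))
           * (\<Sum>j<m. 1 / real (m - j)
               * (deriv ^^ k) (\<lambda>t::real. ln t / (t + 1) ^ (j + 1)) a))) {0<..}"
proof -
  define L where "L = (\<lambda>p q (t::real). ln t ^ p / (t + 1) ^ q)"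
  \<comment> \<open>\<open>Q j i\<close> is the \<open>i\<close>-th derivative of
    \<open>1 / (t + 1) ^ (j + 1)\<close>. \<open>D1 i\<close> and \<open>D2 i\<close> are the
    \<open>i\<close>-th derivatives of the two sides of the closed form; the logarithmic parts
    \<open>L\<close> stay as iterated \<open>deriv\<close>, as in the statement.\<close>
  define Q where "Q = (\<lambda>j i (t::real). (- 1) ^ i * pochhammer (real j + 1) i * (1 / (t + 1) ^ (j + 1 + i)))"
  define D1 where "D1 = (\<lambda>i t. (- 1) ^ i * pochhammer (real m + 1) i * log_kernel_integral m (m + 1 + i) t)"
  define D2 where "D2 = (\<lambda>i t. pi\<^sup>2 / 2 * Q m i t + 1 / 2 * (deriv ^^ i) (L 2 (m + 1)) t
     + (\<Sum>j<m. harm (m - j - 1) / real (m - j) * Q j i t)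
     + (\<Sum>j<m. 1 / real (m - j) * (deriv ^^ i) (L 1 (j + 1)) t))"
  have sgn: "(- 1) ^ i * p * (- r * X) = (- 1) ^ Suc i * (p * r) * X" for p r X :: real and i
    by simp
  have Q: "(Q j i has_real_derivative Q j (Suc i) t) (at t)" if "t > 0" for j i t
  proof -
    have "((\<lambda>t. 1 / (t + 1) ^ (j + 1 + i)) has_real_derivative - real (j + 1 + i) / (t + 1) ^ Suc (j + 1 + i)) (at t)"
      using that DERIV_inverse_power[of "t + 1" "j + 1 + i" UNIV]
        DERIV_shift[of "\<lambda>t. 1 / t ^ (j + 1 + i)" _ t 1] by simp
    also have "- real (j + 1 + i) / (t + 1) ^ Suc (j + 1 + i)
        = - (real j + 1 + real i) * (1 / (t + 1) ^ (j + 1 + Suc i))"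
      by simp
    finally show ?thesis
      unfolding Q_def pochhammer_Suc sgn[symmetric] by (rule DERIV_cmult)
  qed
  have L: "((deriv ^^ i) (L p q) has_real_derivative (deriv ^^ Suc i) (L p q) t) (at t)" if "t > 0" for i p q t
    unfolding L_def by (rule log_rational_higher_deriv[OF ln_power_over_power_log_rational that])
  have D1: "(D1 i has_real_derivative D1 (Suc i) t) (at t)" if "t > 0" for i t
  proof -
    have "(log_kernel_integral m (m + 1 + i) has_real_derivative
        - (real m + 1 + real i) * log_kernel_integral m (m + 1 + Suc i) t) (at t)"
      using DERIV_log_kernel_integral[OF that, of m "m + 1 + i"] by (simp add: algebra_simps)
    thus ?thesis
      unfolding D1_def pochhammer_Suc sgn[symmetric] by (rule DERIV_cmult)
  qed
  have D2: "(D2 i has_real_derivative D2 (Suc i) t) (at t)" if "t > 0" for i t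
    unfolding D2_def by (intro DERIV_add DERIV_cmult DERIV_sum Q L that)
  have D12: "D1 0 t = D2 0 t" if "t > 0" for t
  proof -
    have 1: "(harm (m - j - 1) + ln t) / real (m - j) * (1 / (t + 1) ^ Suc j)
        = harm (m - j - 1) / real (m - j) * Q j 0 t + 1 / real (m - j) * L 1 (j + 1) t" for j
      by (simp add: Q_def L_def add_divide_distrib)
    have 2: "(pi\<^sup>2 + (ln t)\<^sup>2) / 2 * (1 / (t + 1) ^ Suc m) = pi\<^sup>2 / 2 * Q m 0 t + 1 / 2 * L 2 (m + 1) t"
      by (simp add: Q_def L_def add_divide_distrib)
    have "log_kernel_integral m (Suc m) t = D2 0 t"
      unfolding log_kernel_integral_closed_form[OF that] 1 2 sum.distrib D2_def by simp
    thus ?thesis by (simp add: D1_def)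
  qed
  \<comment> \<open>Both families start from the same function for \<open>t > 0\<close>, so both
    give its \<open>k\<close>-th derivative at \<open>a\<close>.\<close>
  have "D1 k a = (deriv ^^ k) (D1 0) a"
    by (rule higher_deriv_eqI[symmetric]) (use D1 assms in auto)
  also have "\<dots> = D2 k a"
    by (rule higher_deriv_eqI) (use D2 D12 assms in auto)
  finally have eq: "D1 k a = D2 k a" .
  \<comment> \<open>\<open>c\<close> is the factor of the integral in \<open>D1 k a\<close>, with
    the rising factorial rewritten by \<open>pochhammer_eq_fact_binomial\<close>.\<close>
  define c where "c = (- 1) ^ k * (fact k * real ((k + m) choose m))"
  have c: "c \<noteq> 0" by (simp add: c_def)
  have "c * log_kernel_integral m (m + 1 + k) a = D2 k a"
    using eq by (simp add: D1_def c_def pochhammer_eq_fact_binomial)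
  hence "log_kernel_integral m (m + 1 + k) a = D2 k a / c"
    using c by (simp add: eq_divide_eq mult.commute)
  also have "\<dots> = pi\<^sup>2 / 2 * Q m k a / c + 1 / 2 * (deriv ^^ k) (L 2 (m + 1)) a / c
     + (\<Sum>j<m. harm (m - j - 1) / real (m - j) * Q j k a / c)
     + 1 / c * (\<Sum>j<m. 1 / real (m - j) * (deriv ^^ k) (L 1 (j + 1)) a)"
    by (simp add: D2_def add_divide_distrib sum_divide_distrib)
  finally have main: "log_kernel_integral m (k + m + 1) a = \<dots>" by (simp add: add_ac)
  have inverse_c: "1 / c = (- 1) ^ k / (fact k * real ((k + m) choose m))"
    by (simp add: c_def divide_simps flip: power_mult_distrib)
  \<comment> \<open>Both \<open>Q j k a\<close> and \<open>c\<close> contain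
    \<open>(- 1) ^ k * fact k\<close>, which cancels; the non-logarithmic terms therefore carry no
    sign.\<close>
  have Qc: "Q j k a / c = real ((k + j) choose j) / real ((k + m) choose m) * (1 / (a + 1) ^ (j + k + 1))" for j
    unfolding Q_def c_def pochhammer_eq_fact_binomial by (simp add: add_ac)
  have 1: "pi\<^sup>2 / 2 * Q m k a / c = pi ^ 2 / (2 * (a + 1) ^ (k + m + 1))"
    unfolding times_divide_eq_right[symmetric] Qc by (simp add: add_ac)
  have 2: "1 / 2 * (deriv ^^ k) (L 2 (m + 1)) a / c = (- 1) ^ k / (2 * fact k * real ((k + m) choose m))
           * (deriv ^^ k) (\<lambda>t::real. (ln t) ^ 2 / (t + 1) ^ (m + 1)) a"
  proof -
    have "1 / 2 * (deriv ^^ k) (L 2 (m + 1)) a / c = 1 / c * (deriv ^^ k) (L 2 (m + 1)) a / 2"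
      by simp
    thus ?thesis unfolding inverse_c by (simp add: L_def)
  qed
  have 3: "harm (m - j - 1) / real (m - j) * Q j k a / c = real ((k + j) choose j) / real ((k + m) choose m)
           * (harm (m - j - 1) / real (m - j)) * (1 / (a + 1) ^ (j + k + 1))" for j
    unfolding times_divide_eq_right[symmetric] Qc by (simp add: mult_ac)
  have "((\<lambda>x. x ^ m * ln x / ((x - 1) * (x + a) ^ (k + m + 1))) has_integral
      log_kernel_integral m (k + m + 1) a) {0<..}"
    unfolding log_kernel_integral_def using assms
    by (intro integrable_integral kernel_integrable) auto
  thus ?thesis unfolding main 1 2 3 inverse_c by (simp add: L_def)
qed

end
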